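(* Let $d\ge 2$ be fixed. For each sufficiently large $k$, there exists a (nonempty) family of $d$-dimensional $k\times\cdots\times k$ permutation matrices $P$ such that $I(P,d)=2^{\Omega(k^{1/d})}$. That is, there exist a constant $c>0$ and an integer $k_0$, depending only on $d$, such that for every $k\ge k_0$ there is a nonempty family of $d$-dimensional $k\times\cdots\times k$ permutation matrices, each member $P$ of which satisfies $I(P,d)\ge 2^{c\,k^{1/d}}$.
   Context: A $d$-dimensional $n_1\times\cdots\times n_d$ zero-one matrix is an array $A=(a_{i_1,\ldots,i_d})$, $1\le i_\ell\le n_\ell$, with entries in $\{0,1\}$. A submatrix is obtained by selecting, for each $\ell$, a set of values of the $\ell$-th coordinate (keeping the order). $A$ contains a $d$-dimensional zero-one matrix $B$ if some submatrix of $A$ can be transformed into $B$ by changing any number of ones to zeros; otherwise $A$ avoids $B$. $f(n,B,d)$ denotes the maximum number of ones in a $d$-dimensional $n\times\cdots\times n$ zero-one matrix that avoids $B$, and $$I(P,d)=\liminf_{n\to\infty}\frac{f(n,P,d)}{n^{d-1}}.$$ An $\ell$-cross section is the set of all entries having a fixed value of the $\ell$-th coordinate. A $d$-dimensional $k\times\cdots\times k$ zero-one matrix is a permutation matrix if each of its $\ell$-cross sections contains exactly one nonzero entry, for every $\ell=1,\ldots,d$. *)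

theory Defs
  imports "HOL-Library.FuncSet" "HOL-Library.Liminf_Limsup" "HOL-Library.Extended_Real"
begin

text \<open>
  The sizes \<open>n\<^sub>1, \<dots>, n\<^sub>d\<close> of a \<open>d\<close>-dimensional matrix are given by a function
  \<open>n :: nat \<Rightarrow> nat\<close>, of which only the values on \<open>{1..d}\<close> matter; index tuples are
  extensional functions on \<open>{1..d}\<close>, and all coordinates count from 1.
\<close>

definition index_set :: "nat \<Rightarrow> (nat \<Rightarrow> nat) \<Rightarrow> (nat \<Rightarrow> nat) set" where
  "index_set d n = (\<Pi>\<^sub>E l\<in>{1..d}. {1..n l})"

definition zero_one_matrices :: "nat \<Rightarrow> (nat \<Rightarrow> nat) \<Rightarrow> ((nat \<Rightarrow> nat) \<Rightarrow> nat) set" where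
  "zero_one_matrices d n = (index_set d n \<rightarrow>\<^sub>E {0, 1})"

definition num_ones :: "nat \<Rightarrow> (nat \<Rightarrow> nat) \<Rightarrow> ((nat \<Rightarrow> nat) \<Rightarrow> nat) \<Rightarrow> nat" where
  "num_ones d n A = card {i \<in> index_set d n. A i = 1}"

text \<open>
  The submatrix of \<open>A\<close> on the selected coordinate values \<open>S 1, \<dots>, S d\<close>: its index
  \<open>i l\<close> in the \<open>l\<close>-th coordinate refers to the \<open>i l\<close>-th smallest element of \<open>S l\<close>.
\<close>

definition submatrix ::
  "nat \<Rightarrow> (nat \<Rightarrow> nat set) \<Rightarrow> ((nat \<Rightarrow> nat) \<Rightarrow> nat) \<Rightarrow> ((nat \<Rightarrow> nat) \<Rightarrow> nat)" where
  "submatrix d S A =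
    (\<lambda>i\<in>index_set d (\<lambda>l. card (S l)).
       A (\<lambda>l\<in>{1..d}. sorted_list_of_set (S l) ! (i l - 1)))"

definition ones_to_zeros ::
  "nat \<Rightarrow> (nat \<Rightarrow> nat) \<Rightarrow> ((nat \<Rightarrow> nat) \<Rightarrow> nat) \<Rightarrow> ((nat \<Rightarrow> nat) \<Rightarrow> nat) \<Rightarrow> bool" where
  "ones_to_zeros d m C B \<longleftrightarrow>
    (\<forall>i\<in>index_set d m. B i = C i \<or> (C i = 1 \<and> B i = 0))"

text \<open>The \<open>n 1 \<times> \<dots> \<times> n d\<close> matrix \<open>A\<close> contains the \<open>m 1 \<times> \<dots> \<times> m d\<close> matrix \<open>B\<close>.\<close>

definition contains_matrix ::
  "nat \<Rightarrow> (nat \<Rightarrow> nat) \<Rightarrow> ((nat \<Rightarrow> nat) \<Rightarrow> nat) \<Rightarrow>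
   (nat \<Rightarrow> nat) \<Rightarrow> ((nat \<Rightarrow> nat) \<Rightarrow> nat) \<Rightarrow> bool" where
  "contains_matrix d n A m B \<longleftrightarrow>
    (\<exists>S. (\<forall>l\<in>{1..d}. S l \<subseteq> {1..n l} \<and> card (S l) = m l) \<and>
         ones_to_zeros d m (submatrix d S A) B)"

text \<open>
  \<open>f(n, B, d)\<close> for an \<open>m 1 \<times> \<dots> \<times> m d\<close> matrix \<open>B\<close>. The maximum is over a finite set,
  which is nonempty whenever \<open>B\<close> has at least one nonzero entry.
\<close>

definition ex_ones :: "nat \<Rightarrow> (nat \<Rightarrow> nat) \<Rightarrow> ((nat \<Rightarrow> nat) \<Rightarrow> nat) \<Rightarrow> nat \<Rightarrow> nat" where
  "ex_ones d m B n =
    Max {num_ones d (\<lambda>_. n) A | A.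
           A \<in> zero_one_matrices d (\<lambda>_. n) \<and> \<not> contains_matrix d (\<lambda>_. n) A m B}"

text \<open>The lower limit is taken in \<open>ereal\<close>, so that its existence needs no boundedness.\<close>

definition I_lim :: "nat \<Rightarrow> (nat \<Rightarrow> nat) \<Rightarrow> ((nat \<Rightarrow> nat) \<Rightarrow> nat) \<Rightarrow> ereal" where
  "I_lim d m B = liminf (\<lambda>n. ereal (real (ex_ones d m B n) / real n ^ (d - 1)))"

definition cross_section :: "nat \<Rightarrow> (nat \<Rightarrow> nat) \<Rightarrow> nat \<Rightarrow> nat \<Rightarrow> (nat \<Rightarrow> nat) set" where
  "cross_section d n l t = {i \<in> index_set d n. i l = t}"

definition permutation_matrices :: "nat \<Rightarrow> nat \<Rightarrow> ((nat \<Rightarrow> nat) \<Rightarrow> nat) set" where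
  "permutation_matrices d k =
    {P \<in> zero_one_matrices d (\<lambda>_. k).
       \<forall>l\<in>{1..d}. \<forall>t\<in>{1..k}. \<exists>!i. i \<in> cross_section d (\<lambda>_. k) l t \<and> P i \<noteq> 0}"

end

theory Submission
  imports Defs
begin

text \<open>
  The proof follows Fox. If a permutation of size \<open>k \<ge> l\<^sup>2\<close> contains the transpose of an
  \<open>l \<times> l\<close> grid, every matrix containing it has the all-ones \<open>l \<times> l\<close> matrix as an interval
  minor: there are \<open>l\<close> disjoint row intervals and \<open>l\<close> disjoint column intervals such that each
  of the \<open>l\<^sup>2\<close> blocks has a nonzero entry. So a dense matrix without such a minor is needed.

  In a matrix of size \<open>2\<^sup>r\<close>, delete each product of two dyadic intervals independently with
  probability \<open>1/M\<close>, where \<open>M\<close> is proportional to \<open>r\<close>. An entry lies in \<open>(r + 1)\<^sup>2\<close> of these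
  products, so the density is at least \<open>(3/4)\<^sup>r\<close>, and there are \<open>(3/2)\<^sup>r\<close> ones per row. The
  smallest dyadic intervals containing \<open>m\<close> disjoint intervals are distinct; together with their
  ancestors they form a subtree of the dyadic tree with \<open>X \<ge> m\<close> vertices. An \<open>m \<times> m\<close> minor
  hence gives two subtrees with \<open>X\<close> and \<open>Y\<close> vertices, none of whose \<open>XY\<close> products is deleted.
  There are only exponentially many such pairs of subtrees in \<open>X + Y\<close>, and \<open>XY\<close> is at least
  \<open>m (X + Y) / 2\<close>, so no minor occurs for some \<open>m\<close> proportional to \<open>r\<close>.

  Block diagonal copies extend this to all sizes. In dimension \<open>d\<close> the matrix is taken constant
  in the coordinates \<open>3, \<dots>, d\<close>, which reduces the claim to \<open>d = 2\<close> with \<open>k\<^bsup>1/2\<^esup>\<close> in the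
  exponent, and this is at least \<open>k\<^bsup>1/d\<^esup>\<close>.
\<close>

subsection \<open>Rooted subtrees of the binary tree\<close>

text \<open>A vertex is the path to it from the root, and a subtree the set of its vertices.\<close>

fun subtrees :: "nat \<Rightarrow> bool list set set" where
  "subtrees 0 = {{}}"
| "subtrees (Suc h) =
     insert {} ((\<lambda>(S, T). insert [] ((#) True ` S \<union> (#) False ` T)) ` (subtrees h \<times> subtrees h))"

lemma finite_subtrees: "finite (subtrees h)"
  by (induction h) auto

lemma subtrees_length_less: "S \<in> subtrees h \<Longrightarrow> w \<in> S \<Longrightarrow> length w < h"
  by (induction h arbitrary: S w) fastforce+

lemma finite_bool_lists_length_less: "finite {w :: bool list. length w < h}"
proof -
  have "{w :: bool list. length w < h} = (\<Union>i<h. {w. length w = i})" by auto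
  moreover have "finite {w :: bool list. length w = i}" for i
    using finite_lists_length_eq[of "UNIV :: bool set" i] by simp
  ultimately show ?thesis by simp
qed

lemma finite_subtree: "S \<in> subtrees h \<Longrightarrow> finite S"
  by (rule finite_subset[OF _ finite_bool_lists_length_less[of h]])
     (auto dest: subtrees_length_less)

text \<open>A nonempty prefix-closed set contains the root; sorting its other paths by their first
  step leaves two prefix-closed sets of smaller height.\<close>

lemma prefix_closed_in_subtrees:
  assumes "\<And>w. w \<in> S \<Longrightarrow> length w < h"
    and "\<And>w u. w \<in> S \<Longrightarrow> take u w \<in> S"
  shows "S \<in> subtrees h"
  using assms
proof (induction h arbitrary: S)
  case 0
  then have "S = {}" by blast
  then show ?case by simp
next
  case (Suc h)
  show ?case
  proof (cases "S = {}")
    case False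
    let ?S = "\<lambda>b. {w. b # w \<in> S}"
    have child: "?S b \<in> subtrees h" for b
    proof (rule Suc.IH)
      show "length w < h" if "w \<in> ?S b" for w
        using Suc.prems(1)[of "b # w"] that by simp
      show "take u w \<in> ?S b" if "w \<in> ?S b" for w u
        using Suc.prems(2)[of "b # w" "Suc u"] that by simp
    qed
    have "[] \<in> S" using False Suc.prems(2)[of _ 0] by auto
    have "insert [] ((#) True ` ?S True \<union> (#) False ` ?S False) \<in> subtrees (Suc h)"
      using child by auto
    moreover have "S = insert [] ((#) True ` ?S True \<union> (#) False ` ?S False)"
    proof (intro set_eqI)
      fix w
      show "w \<in> S \<longleftrightarrow> w \<in> insert [] ((#) True ` ?S True \<union> (#) False ` ?S False)"
      proof (cases w)
        case (Cons b v)
        then show ?thesis by (cases b) auto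
      qed (simp add: \<open>[] \<in> S\<close>)
    qed
    ultimately show ?thesis by argo
  qed simp
qed

text \<open>
  With \<open>W\<close> the sum at height \<open>h\<close>, the recursion is \<open>W \<mapsto> 1 + W\<^sup>2 / 4\<close>, whose fixed point is 2.
\<close>

lemma sum_subtrees_quarter: "(\<Sum>S\<in>subtrees h. (1/4 :: real) ^ card S) \<le> 2"
proof (induction h)
  case (Suc h)
  let ?W = "\<Sum>S\<in>subtrees h. (1/4 :: real) ^ card S"
  let ?f = "\<lambda>(S, T). insert [] ((#) True ` S \<union> (#) False ` T)"
  let ?g = "\<lambda>S :: bool list set. (1/4 :: real) ^ card S"
  have card_f: "card (?f (S, T)) = Suc (card S + card T)"
    if "S \<in> subtrees h" "T \<in> subtrees h" for S T
  proof -
    have "finite S" "finite T" using that finite_subtree by blast+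
    moreover have "card ((#) True ` S \<union> (#) False ` T) = card S + card T"
      using calculation by (subst card_Un_disjoint) (auto simp: card_image)
    moreover have "[] \<notin> (#) True ` S \<union> (#) False ` T" by auto
    ultimately show ?thesis by simp
  qed
  have "(\<Sum>S\<in>subtrees (Suc h). ?g S) \<le> ?g {} + (\<Sum>S\<in>?f ` (subtrees h \<times> subtrees h). ?g S)"
    using finite_subtrees[of h] by (simp add: sum.insert_if)
  also have "(\<Sum>S\<in>?f ` (subtrees h \<times> subtrees h). ?g S)
      \<le> (\<Sum>p\<in>subtrees h \<times> subtrees h. (?g \<circ> ?f) p)"
    by (rule sum_image_le) (auto simp: finite_subtrees)
  also have "\<dots> = (\<Sum>(S, T)\<in>subtrees h \<times> subtrees h. (1/4) * (?g S * ?g T))"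
    by (rule sum.cong) (auto simp: card_f[simplified] power_add)
  also have "\<dots> = (1/4) * (?W * ?W)"
    unfolding sum_product sum.cartesian_product[symmetric] by (simp add: sum_distrib_left)
  also have "\<dots> \<le> (1/4) * (2 * 2)"
    using Suc by (intro mult_left_mono mult_mono) (auto intro: sum_nonneg)
  finally show ?case by simp
qed simp

text \<open>Half of the weight, \<open>(1/2) ^ card S\<close>, supplies the decay in
  \<open>m\<close>; the rest, \<open>(1/4) ^ card S\<close>, has sum at most 2.\<close>

lemma sum_large_subtrees_eighth:
  "(\<Sum>S\<in>{S \<in> subtrees h. m \<le> card S}. (1/8 :: real) ^ card S) \<le> 2 * (1/2) ^ m"
proof -
  have "(\<Sum>S\<in>{S \<in> subtrees h. m \<le> card S}. (1/8 :: real) ^ card S)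
      \<le> (\<Sum>S\<in>{S \<in> subtrees h. m \<le> card S}. (1/2) ^ m * (1/4) ^ card S)"
  proof (rule sum_mono)
    fix S assume "S \<in> {S \<in> subtrees h. m \<le> card S}"
    then have "(1/2 :: real) ^ card S \<le> (1/2) ^ m" by (intro power_decreasing) auto
    then have "(1/2 :: real) ^ card S * (1/4) ^ card S \<le> (1/2) ^ m * (1/4) ^ card S"
      by (intro mult_right_mono) auto
    then show "(1/8 :: real) ^ card S \<le> (1/2) ^ m * (1/4) ^ card S"
      by (simp add: power_mult_distrib[symmetric])
  qed
  also have "\<dots> \<le> (\<Sum>S\<in>subtrees h. (1/2) ^ m * (1/4) ^ card S)"
    by (rule sum_mono2) (auto simp: finite_subtrees)
  also have "\<dots> = (1/2) ^ m * (\<Sum>S\<in>subtrees h. (1/4) ^ card S)"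
    by (simp add: sum_distrib_left)
  also have "\<dots> \<le> (1/2) ^ m * 2"
    by (intro mult_left_mono sum_subtrees_quarter) simp
  finally show ?thesis by simp
qed

subsection \<open>Dyadic nodes of intervals\<close>

text \<open>The \<open>r\<close> binary digits of \<open>x < 2 ^ r\<close>, leading digit first:
  \<open>take u (path r x)\<close> is the dyadic interval of length \<open>2 ^ (r - u)\<close> that
  contains \<open>x\<close>.\<close>

fun path :: "nat \<Rightarrow> nat \<Rightarrow> bool list" where
  "path 0 x = []"
| "path (Suc r) x = (2 ^ r \<le> x) # path r (if 2 ^ r \<le> x then x - 2 ^ r else x)"

lemma length_path [simp]: "length (path r x) = r"
  by (induction r arbitrary: x) auto

text \<open>Numbers are ordered lexicographically by their digits; \<open>u\<close> is the first
  difference, where the smallest dyadic interval containing both is halved.\<close>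

lemma path_less_imp_split:
  "x < y \<Longrightarrow> y < 2 ^ r \<Longrightarrow>
    \<exists>u<r. take u (path r x) = take u (path r y) \<and> \<not> path r x ! u \<and> path r y ! u"
proof (induction r arbitrary: x y)
  case (Suc r)
  show ?case
  proof (cases "(2 ^ r \<le> x) = (2 ^ r \<le> y)")
    case True
    define f where "f z = (if 2 ^ r \<le> z then z - 2 ^ r else z)" for z :: nat
    have "f x < f y" "f y < 2 ^ r" using Suc.prems True by (auto simp: f_def)
    from Suc.IH[OF this] obtain u where
      "u < r" "take u (path r (f x)) = take u (path r (f y))"
      "\<not> path r (f x) ! u" "path r (f y) ! u" by blast
    moreover have "path (Suc r) z = (2 ^ r \<le> z) # path r (f z)" for z by (simp add: f_def)
    ultimately show ?thesis
      using True by (intro exI[of _ "Suc u"]) (simp del: path.simps)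
  next
    case False
    then have "\<not> 2 ^ r \<le> x" "2 ^ r \<le> y" using Suc.prems by auto
    then show ?thesis by (intro exI[of _ 0]) simp
  qed
qed simp

lemma path_split_imp_less:
  "x < 2 ^ r \<Longrightarrow> u < r \<Longrightarrow> take u (path r x) = take u (path r y) \<Longrightarrow>
    \<not> path r x ! u \<Longrightarrow> path r y ! u \<Longrightarrow> x < y"
proof (induction r arbitrary: x y u)
  case (Suc r)
  show ?case
  proof (cases u)
    case 0
    then show ?thesis using Suc.prems by simp
  next
    case (Suc v)
    define f where "f z = (if 2 ^ r \<le> z then z - 2 ^ r else z)" for z :: nat
    have p: "path (Suc r) z = (2 ^ r \<le> z) # path r (f z)" for z by (simp add: f_def)
    have eq: "(2 ^ r \<le> x) = (2 ^ r \<le> y)"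
      using Suc.prems(3) Suc by (simp add: p del: path.simps)
    have "f x < 2 ^ r" using Suc.prems(1) by (auto simp: f_def)
    moreover have "v < r" using Suc.prems(2) Suc by simp
    ultimately have "f x < f y"
      using Suc.IH[of "f x" v "f y"] Suc.prems(3-5) Suc by (simp add: p del: path.simps)
    then show ?thesis using eq by (auto simp: f_def split: if_splits)
  qed
qed simp

text \<open>Dyadic intervals are convex: if \<open>i\<close> left the one shared by \<open>x\<close>
  and \<open>y\<close>, it would turn right where both of them turn left, giving
  \<open>y < i\<close>.\<close>

lemma take_path_between:
  assumes "x \<le> i" "i \<le> y" "y < 2 ^ r" "u \<le> r"
    and eq: "take u (path r x) = take u (path r y)"
  shows "take u (path r i) = take u (path r x)"
proof (cases "x = i")
  case False
  then obtain v where v: "v < r" "take v (path r x) = take v (path r i)"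
      "\<not> path r x ! v" "path r i ! v"
    using path_less_imp_split[of x i r] assms by auto
  have "u \<le> v"
  proof (rule ccontr)
    assume "\<not> u \<le> v"
    then have "v < u" by simp
    have "take v (path r y) = take v (path r i)"
      using eq v(2) \<open>v < u\<close> by (metis min.absorb1 less_imp_le_nat take_take)
    moreover have "\<not> path r y ! v"
      using eq v(3) \<open>v < u\<close> by (metis nth_take)
    ultimately have "y < i" using v path_split_imp_less assms by blast
    then show False using assms by simp
  qed
  then show ?thesis using v(2) by (metis min.absorb1 take_take)
qed simp

definition common_prefixes :: "nat \<Rightarrow> nat \<Rightarrow> nat \<Rightarrow> bool list set" where
  "common_prefixes r x y = {take u (path r x) | u. u \<le> r \<and> take u (path r x) = take u (path r y)}"

definition nodes :: "nat \<Rightarrow> nat \<Rightarrow> (nat \<Rightarrow> nat) \<Rightarrow> (nat \<Rightarrow> nat) \<Rightarrow> bool list set" where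
  "nodes r m x y = (\<Union>a<m. common_prefixes r (x a) (y a))"

definition prefixes :: "nat \<Rightarrow> nat \<Rightarrow> bool list set" where
  "prefixes r i = {take u (path r i) | u. u \<le> r}"

lemma card_prefixes: "card (prefixes r i) = Suc r"
proof -
  have "prefixes r i = (\<lambda>u. take u (path r i)) ` {..r}" by (auto simp: prefixes_def)
  moreover have "inj_on (\<lambda>u. take u (path r i)) {..r}"
    by (rule inj_on_inverseI[of _ length]) simp
  ultimately show ?thesis by (simp add: card_image)
qed

lemma common_prefixes_subset:
  assumes "w \<in> common_prefixes r x y" "i \<in> {x..y}" "y < 2 ^ r"
  shows "w \<in> prefixes r i"
proof -
  obtain u where u: "u \<le> r" "w = take u (path r x)" "take u (path r x) = take u (path r y)"
    using assms(1) unfolding common_prefixes_def by blast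
  then have "w = take u (path r i)"
    using take_path_between[of x i y r u] assms by simp
  then show ?thesis using u(1) unfolding prefixes_def by blast
qed

text \<open>A prefix of a common prefix is a common prefix. The height is \<open>Suc r\<close>
  because single points are vertices at depth \<open>r\<close>.\<close>

lemma nodes_in_subtrees: "nodes r m x y \<in> subtrees (Suc r)"
proof (rule prefix_closed_in_subtrees)
  fix w v assume "w \<in> nodes r m x y"
  then obtain a u where a: "a < m" "u \<le> r" "w = take u (path r (x a))"
      "take u (path r (x a)) = take u (path r (y a))"
    by (auto simp: nodes_def common_prefixes_def)
  then show "length w < Suc r" by simp
  have "take (min v u) (path r (x a)) = take (min v u) (path r (y a))"
    using a(4) by (metis take_take)
  then have "take v w \<in> common_prefixes r (x a) (y a)"
    using a unfolding common_prefixes_def by (auto intro!: exI[of _ "min v u"])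
  then show "take v w \<in> nodes r m x y"
    using a by (auto simp: nodes_def)
qed

definition interval_family :: "nat \<Rightarrow> nat \<Rightarrow> (nat \<Rightarrow> nat) \<Rightarrow> (nat \<Rightarrow> nat) \<Rightarrow> bool" where
  "interval_family n m x y \<longleftrightarrow>
     (\<forall>a<m. x a \<le> y a \<and> y a < n) \<and> (\<forall>a<m. \<forall>a'<a. y a' < x a)"

text \<open>
  Disjoint intervals have distinct smallest dyadic superintervals: each interval that is not
  a single point crosses the middle of its own.
\<close>

lemma card_nodes_ge:
  assumes "interval_family (2 ^ r) m x y"
  shows "m \<le> card (nodes r m x y)"
proof -
  \<comment> \<open>The witness is the smallest dyadic interval containing both ends: a leaf for a
    single point, otherwise the vertex where the two paths part.\<close>
  have "\<exists>w. w \<in> common_prefixes r (x a) (y a) \<and>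
      (x a = y a \<and> length w = r \<or>
       length w < r \<and> \<not> path r (x a) ! length w \<and> path r (y a) ! length w)" if "a < m" for a
  proof (cases "x a = y a")
    case True
    have "path r (x a) \<in> common_prefixes r (x a) (y a)"
      unfolding common_prefixes_def using True by (auto intro!: exI[of _ r])
    then show ?thesis using True by (intro exI[of _ "path r (x a)"]) simp
  next
    case False
    moreover have "x a \<le> y a" "y a < 2 ^ r"
      using assms that unfolding interval_family_def by blast+
    ultimately have "x a < y a" "y a < 2 ^ r" by linarith+
    from path_less_imp_split[OF this] obtain u where "u < r"
      "take u (path r (x a)) = take u (path r (y a))" "\<not> path r (x a) ! u" "path r (y a) ! u"
      by blast
    moreover have "take u (path r (x a)) \<in> common_prefixes r (x a) (y a)"
      unfolding common_prefixes_def using calculation by (auto intro!: exI[of _ u])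
    ultimately show ?thesis by (intro exI[of _ "take u (path r (x a))"]) simp
  qed
  then obtain w where w: "\<And>a. a < m \<Longrightarrow> w a \<in> common_prefixes r (x a) (y a)"
    "\<And>a. a < m \<Longrightarrow> x a = y a \<and> length (w a) = r \<or>
       length (w a) < r \<and> \<not> path r (x a) ! length (w a) \<and> path r (y a) ! length (w a)"
    by metis
  have take_w: "take (length (w a)) (path r (x a)) = w a"
    "take (length (w a)) (path r (y a)) = w a" if a: "a < m" for a
  proof -
    obtain u where "u \<le> r" "w a = take u (path r (x a))" "w a = take u (path r (y a))"
      using w(1)[OF a] unfolding common_prefixes_def by force
    then show "take (length (w a)) (path r (x a)) = w a"
      "take (length (w a)) (path r (y a)) = w a"
      by (metis length_path length_take min.absorb2)+
  qed
  \<comment> \<open>From a common vertex above the leaves, \<open>x a\<close> turns left and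
    \<open>y a'\<close> right, so \<open>x a < y a'\<close>; a common leaf makes their paths equal.
    Both contradict \<open>y a' < x a\<close>.\<close>
  have "w a' \<noteq> w a" if "a' < a" "a < m" for a a'
  proof
    assume eq: "w a' = w a"
    have bounds: "y a' < x a" "x a \<le> y a" "y a < 2 ^ r"
      using assms that unfolding interval_family_def by blast+
    then have less: "y a' < x a" "x a < 2 ^ r" "a' < m" using that by linarith+
    from path_less_imp_split[OF less(1,2)] obtain v where
      v: "v < r" "take v (path r (y a')) = take v (path r (x a))"
        "\<not> path r (y a') ! v" "path r (x a) ! v" by blast
    show False
    proof (cases "length (w a) = r")
      case True
      then have "path r (y a') = path r (x a)"
        using take_w[OF that(2)] take_w[OF less(3)] eq by simp
      then show False using v by simp
    next
      case False
      then have l: "length (w a) < r" "\<not> path r (x a) ! length (w a)" "path r (y a') ! length (w a)"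
        using w(2)[OF that(2)] w(2)[OF less(3)] eq by auto
      have "x a < y a'"
        using path_split_imp_less[OF less(2) l(1) _ l(2,3)]
          take_w(1)[OF that(2)] take_w(2)[OF less(3)] eq by simp
      then show False using less by simp
    qed
  qed
  then have "inj_on w {..<m}"
    by (intro linorder_inj_onI) auto
  then have "m = card (w ` {..<m})" by (simp add: card_image)
  also have "\<dots> \<le> card (nodes r m x y)"
    using w(1) by (intro card_mono finite_subtree[OF nodes_in_subtrees])
      (auto simp: nodes_def)
  finally show ?thesis .
qed

subsection \<open>Random matrices without large grid minors\<close>

definition grid_minor :: "nat \<Rightarrow> nat \<Rightarrow> (nat \<times> nat) set \<Rightarrow> bool" where
  "grid_minor n m A \<longleftrightarrow>
     (\<exists>x y x' y'. interval_family n m x y \<and> interval_family n m x' y' \<and>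
        (\<forall>a<m. \<forall>b<m. \<exists>i\<in>{x a..y a}. \<exists>j\<in>{x' b..y' b}. (i, j) \<in> A))"

definition vertex_pairs :: "nat \<Rightarrow> (bool list \<times> bool list) set" where
  "vertex_pairs r = {w. length w < Suc r} \<times> {w. length w < Suc r}"

text \<open>The pairs \<open>e\<close> with \<open>g e = 0\<close> are the deleted products of dyadic intervals.\<close>

definition entries :: "nat \<Rightarrow> (bool list \<times> bool list \<Rightarrow> nat) \<Rightarrow> (nat \<times> nat) set" where
  "entries r g = {p \<in> {..<2 ^ r} \<times> {..<2 ^ r}.
     \<forall>e\<in>prefixes r (fst p) \<times> prefixes r (snd p). g e \<noteq> 0}"

text \<open>Probability in counting form: under a uniform \<open>g\<close>, the pairs are sent to 0
  independently, each with probability \<open>1 / M\<close>.\<close>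

lemma card_nonzero_functions:
  assumes "finite V" "R \<subseteq> V" "M > 0"
  shows "real (card {g \<in> V \<rightarrow>\<^sub>E {..<M}. \<forall>e\<in>R. g e \<noteq> 0})
    = real (card (V \<rightarrow>\<^sub>E {..<M})) * (1 - 1 / real M) ^ card R"
proof -
  have "{g \<in> V \<rightarrow>\<^sub>E {..<M}. \<forall>e\<in>R. g e \<noteq> 0} = (\<Pi>\<^sub>E e\<in>V. if e \<in> R then {1..<M} else {..<M})"
    using assms(2) by (fastforce simp: PiE_iff split: if_splits)
  then have "card {g \<in> V \<rightarrow>\<^sub>E {..<M}. \<forall>e\<in>R. g e \<noteq> 0} =
      (\<Prod>e\<in>V. if e \<in> R then M - 1 else M)"
    using assms(1) by (simp add: card_PiE if_distrib cong: if_cong)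
  also have "\<dots> = (M - 1) ^ card R * M ^ (card V - card R)"
    using assms by (simp add: prod.If_cases Int_absorb1 card_Diff_subset finite_subset
        Diff_eq[symmetric])
  finally have "real (card {g \<in> V \<rightarrow>\<^sub>E {..<M}. \<forall>e\<in>R. g e \<noteq> 0}) =
      real (M - 1) ^ card R * real M ^ (card V - card R)" by simp
  moreover have "real (card (V \<rightarrow>\<^sub>E {..<M})) = real M ^ (card V - card R) * real M ^ card R"
    using assms card_mono[OF assms(1,2)] by (simp add: card_PiE power_add[symmetric])
  moreover have "real (M - 1) ^ card R = real M ^ card R * (1 - 1 / real M) ^ card R"
    using assms(3) by (simp add: power_mult_distrib[symmetric] field_simps)
  ultimately show ?thesis by (simp add: algebra_simps)
qed

text \<open>A row vertex contains a whole interval \<open>a\<close>, a column vertex a whole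
  interval \<open>b\<close>. Their product contains the entry found in block \<open>(a, b)\<close>,
  so it was not deleted.\<close>

lemma grid_minor_imp_nonzero_subtrees:
  assumes "grid_minor (2 ^ r) m (entries r g)"
  shows "\<exists>S\<in>subtrees (Suc r). \<exists>T\<in>subtrees (Suc r).
    m \<le> card S \<and> m \<le> card T \<and> (\<forall>e\<in>S \<times> T. g e \<noteq> 0)"
proof -
  obtain x y x' y' where fam: "interval_family (2 ^ r) m x y" "interval_family (2 ^ r) m x' y'"
    and one: "\<And>a b. a < m \<Longrightarrow> b < m \<Longrightarrow>
      \<exists>i\<in>{x a..y a}. \<exists>j\<in>{x' b..y' b}. (i, j) \<in> entries r g"
    using assms unfolding grid_minor_def by blast
  have "g (v, w) \<noteq> 0" if vw: "v \<in> nodes r m x y" "w \<in> nodes r m x' y'" for v w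
  proof -
    obtain a b where ab: "a < m" "b < m"
      "v \<in> common_prefixes r (x a) (y a)" "w \<in> common_prefixes r (x' b) (y' b)"
      using vw by (auto simp: nodes_def)
    obtain i j where ij: "i \<in> {x a..y a}" "j \<in> {x' b..y' b}" "(i, j) \<in> entries r g"
      using one[OF ab(1,2)] by blast
    have "y a < 2 ^ r" "y' b < 2 ^ r" using fam ab by (auto simp: interval_family_def)
    then have "v \<in> prefixes r i" "w \<in> prefixes r j"
      using common_prefixes_subset ab ij by blast+
    then show ?thesis using ij(3) unfolding entries_def by auto
  qed
  then show ?thesis
    using nodes_in_subtrees card_nodes_ge fam by (metis mem_Times_iff prod.collapse)
qed

text \<open>
  If \<open>p\<^bsup>m/2\<^esup> \<le> 1/8\<close> and \<open>X, Y \<ge> m\<close>, then \<open>p\<^bsup>XY\<^esup> \<le> 8\<^bsup>-X-Y\<^esup>\<close>, which beats the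
  number of pairs of subtrees with \<open>X\<close> and \<open>Y\<close> vertices.
\<close>

lemma prob_power_le:
  fixes p :: real
  assumes "0 \<le> p" "p \<le> 1" "p ^ h \<le> 1/8" "2 * h \<le> X" "2 * h \<le> Y"
  shows "p ^ (X * Y) \<le> (1/8) ^ X * (1/8) ^ Y"
proof -
  have "2 * (h * (X + Y)) = (2 * h) * Y + (2 * h) * X" by (simp add: algebra_simps)
  also have "\<dots> \<le> X * Y + Y * X" using assms by (intro add_mono mult_right_mono) auto
  finally have "h * (X + Y) \<le> X * Y" by (simp add: mult.commute[of Y X])
  then have "p ^ (X * Y) \<le> p ^ (h * (X + Y))"
    using assms by (intro power_decreasing) auto
  also have "\<dots> = (p ^ h) ^ (X + Y)" by (simp add: power_mult)
  also have "\<dots> \<le> (1/8) ^ (X + Y)" using assms by (intro power_mono) auto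
  finally show ?thesis by (simp add: power_add)
qed

text \<open>Union bound over pairs of subtrees with at least \<open>2 * h\<close> vertices each; the
  bound for a single pair is a product, so the sum factors.\<close>

lemma card_grid_minor_functions_le:
  assumes M: "M > 0" and h: "(1 - 1 / real M) ^ h \<le> 1/8"
  shows "real (card {g \<in> vertex_pairs r \<rightarrow>\<^sub>E {..<M}. grid_minor (2 ^ r) (2 * h) (entries r g)})
    \<le> real (card (vertex_pairs r \<rightarrow>\<^sub>E {..<M})) * (4 * (1/4) ^ (2 * h))"
proof -
  let ?W = "vertex_pairs r \<rightarrow>\<^sub>E {..<M}"
  let ?p = "1 - 1 / real M"
  let ?C = "{S \<in> subtrees (Suc r). 2 * h \<le> card S}"
  let ?N = "\<lambda>(S, T). {g \<in> ?W. \<forall>e\<in>S \<times> T. g e \<noteq> 0}"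
  have fin: "finite (vertex_pairs r)"
    by (simp add: vertex_pairs_def finite_bool_lists_length_less)
  have finW: "finite ?W" using fin by (simp add: finite_PiE)
  have finC: "finite ?C" using finite_subtrees[of "Suc r"] by simp
  have p: "0 \<le> ?p" "?p \<le> 1" using M by auto
  have "{g \<in> ?W. grid_minor (2 ^ r) (2 * h) (entries r g)} \<subseteq> (\<Union>q\<in>?C \<times> ?C. ?N q)"
  proof
    fix g assume g: "g \<in> {g \<in> ?W. grid_minor (2 ^ r) (2 * h) (entries r g)}"
    then obtain S T where "(S, T) \<in> ?C \<times> ?C" "\<forall>e\<in>S \<times> T. g e \<noteq> 0"
      using grid_minor_imp_nonzero_subtrees[of r "2 * h" g] by blast
    moreover have "g \<in> ?W" using g by blast
    ultimately show "g \<in> (\<Union>q\<in>?C \<times> ?C. ?N q)" by (intro UN_I[of "(S, T)"]) simp_all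
  qed
  then have "card {g \<in> ?W. grid_minor (2 ^ r) (2 * h) (entries r g)} \<le> card (\<Union>q\<in>?C \<times> ?C. ?N q)"
    using finW finC by (intro card_mono) auto
  also have "\<dots> \<le> (\<Sum>q\<in>?C \<times> ?C. card (?N q))"
    using finC by (intro card_UN_le) auto
  finally have "real (card {g \<in> ?W. grid_minor (2 ^ r) (2 * h) (entries r g)})
      \<le> (\<Sum>q\<in>?C \<times> ?C. real (card (?N q)))"
    by (simp only: of_nat_le_iff of_nat_sum[symmetric])
  also have "\<dots> \<le> (\<Sum>(S, T)\<in>?C \<times> ?C. real (card ?W) * ((1/8) ^ card S * (1/8) ^ card T))"
  proof (rule sum_mono, clarify)
    fix S T assume ST: "S \<in> subtrees (Suc r)" "2 * h \<le> card S"
      "T \<in> subtrees (Suc r)" "2 * h \<le> card T"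
    have "S \<times> T \<subseteq> vertex_pairs r"
      using subtrees_length_less ST unfolding vertex_pairs_def by blast
    then have "real (card (?N (S, T))) = real (card ?W) * ?p ^ card (S \<times> T)"
      unfolding prod.case by (intro card_nonzero_functions fin M)
    also have "\<dots> \<le> real (card ?W) * ((1/8) ^ card S * (1/8) ^ card T)"
      unfolding card_cartesian_product
      using prob_power_le[OF p h ST(2,4)] by (intro mult_left_mono) auto
    finally show "real (card {g \<in> ?W. \<forall>e\<in>S \<times> T. g e \<noteq> 0})
        \<le> real (card ?W) * ((1/8) ^ card S * (1/8) ^ card T)" by simp
  qed
  also have "\<dots> = real (card ?W) * ((\<Sum>S\<in>?C. (1/8) ^ card S) * (\<Sum>T\<in>?C. (1/8) ^ card T))"
    unfolding sum_product sum.cartesian_product[symmetric] by (simp add: sum_distrib_left)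
  also have "\<dots> \<le> real (card ?W) * ((2 * (1/2) ^ (2 * h)) * (2 * (1/2) ^ (2 * h)))"
    by (intro mult_left_mono mult_mono sum_large_subtrees_eighth) (auto intro!: sum_nonneg)
  also have "(2 * (1/2) ^ (2 * h)) * (2 * (1/2) ^ (2 * h)) = 4 * (1/4 :: real) ^ (2 * h)"
    by (simp add: power_mult_distrib[symmetric])
  finally show ?thesis .
qed

text \<open>Linearity of expectation: each of the \<open>4 ^ r\<close> positions remains exactly
  when all \<open>Suc r * Suc r\<close> products containing it remain.\<close>

lemma sum_card_entries:
  assumes "M > 0"
  shows "(\<Sum>g\<in>vertex_pairs r \<rightarrow>\<^sub>E {..<M}. real (card (entries r g)))
    = real (card (vertex_pairs r \<rightarrow>\<^sub>E {..<M})) * (4 ^ r * (1 - 1 / real M) ^ (Suc r * Suc r))"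
proof -
  let ?W = "vertex_pairs r \<rightarrow>\<^sub>E {..<M}"
  let ?B = "{..<2 ^ r} \<times> {..<2 ^ r} :: (nat \<times> nat) set"
  let ?R = "\<lambda>p. prefixes r (fst p) \<times> prefixes r (snd p)"
  have fin: "finite (vertex_pairs r)"
    by (simp add: vertex_pairs_def finite_bool_lists_length_less)
  have finW: "finite ?W" using fin by (simp add: finite_PiE)
  have R: "?R p \<subseteq> vertex_pairs r" for p
    by (auto simp: prefixes_def vertex_pairs_def)
  have "(\<Sum>g\<in>?W. real (card (entries r g))) = (\<Sum>g\<in>?W. \<Sum>p\<in>?B. if \<forall>e\<in>?R p. g e \<noteq> 0 then 1 else 0)"
    unfolding entries_def by (simp add: sum.If_cases Int_def)
  also have "\<dots> = (\<Sum>p\<in>?B. \<Sum>g\<in>?W. if \<forall>e\<in>?R p. g e \<noteq> 0 then 1 else 0)"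
    by (rule sum.swap)
  also have "\<dots> = (\<Sum>p\<in>?B. real (card {g \<in> ?W. \<forall>e\<in>?R p. g e \<noteq> 0}))"
    using finW by (simp add: sum.If_cases Int_def)
  also have "\<dots> = (\<Sum>p\<in>?B. real (card ?W) * (1 - 1 / real M) ^ (Suc r * Suc r))"
    by (simp only: card_nonzero_functions[OF fin R assms] card_cartesian_product card_prefixes)
  also have "\<dots> = real (card ?W) * (4 ^ r * (1 - 1 / real M) ^ (Suc r * Suc r))"
    by (simp add: power_mult_distrib[symmetric])
  finally show ?thesis .
qed

text \<open>First moment: if every \<open>g\<close> gave a minor or too few ones, the mean number of
  ones would be at most half of its lower bound \<open>4 ^ r * (3/4) ^ r\<close> plus
  \<open>4 ^ r\<close> times the tiny probability of a minor.\<close>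

lemma ex_dense_no_grid_minor:
  assumes r: "r \<ge> 1"
  shows "\<exists>A \<subseteq> {..<2 ^ r} \<times> {..<2 ^ r}. \<not> grid_minor (2 ^ r) (96 * r) A \<and>
    2 ^ r * ((3/2) ^ r / 2) \<le> real (card A)"
proof (rule ccontr)
  assume no: "\<not> ?thesis"
  \<comment> \<open>\<open>M\<close> is chosen for the density \<open>(3/4)\<^sup>r\<close>, and then \<open>96 r = 2 (3 M)\<close> for
    \<open>(1 - 1/M)\<^bsup>3M\<^esup> \<le> 1/8\<close>.\<close>
  define M where "M = 16 * r"
  have M: "M > 0" "real M = 16 * real r" using r by (auto simp: M_def)
  let ?W = "vertex_pairs r \<rightarrow>\<^sub>E {..<M}"
  let ?p = "1 - 1 / real M"
  let ?G = "{g \<in> ?W. grid_minor (2 ^ r) (96 * r) (entries r g)}"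
  have finW: "finite ?W"
    by (simp add: vertex_pairs_def finite_bool_lists_length_less finite_PiE)
  have W: "real (card ?W) > 0"
    using M finW by (auto simp: card_gt_0_iff PiE_eq_empty_iff)
  have p: "0 \<le> ?p" "?p \<le> 1" using M r by (auto simp: field_simps)
  \<comment> \<open>As \<open>exp 1 \<ge> 2\<close>, the \<open>M\<close>-th power is at most 1/2,
    and its cube at most 1/8.\<close>
  have "?p ^ M \<le> exp (- 1 / real M) ^ M"
    using p exp_ge_add_one_self[of "- 1 / real M"] by (intro power_mono) auto
  also have "\<dots> = exp (- 1)"
    using M by (simp add: exp_of_nat_mult[symmetric])
  also have "\<dots> \<le> 1 / 2"
    using exp_ge_add_one_self[of 1] by (simp add: exp_minus field_simps)
  finally have "?p ^ M \<le> 1 / 2" .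
  then have "(?p ^ M) ^ 3 \<le> (1/2) ^ 3" using p by (intro power_mono) auto
  moreover have "(?p ^ M) ^ 3 = ?p ^ (3 * M)" by (metis mult.commute power_mult)
  moreover have "(1/2 :: real) ^ 3 = 1 / 8" by (simp add: power3_eq_cube)
  ultimately have "?p ^ (3 * M) \<le> 1 / 8" by simp
  from card_grid_minor_functions_le[OF M(1) this, of r]
  have G: "real (card ?G) \<le> real (card ?W) * (4 * (1/4) ^ (96 * r))"
    by (simp add: M_def mult.assoc)
  \<comment> \<open>Bernoulli's inequality with \<open>4 * r / M = 1/4\<close>; the
    \<open>r\<close>-th power then covers the exponent since
    \<open>Suc r \<le> 2 * r\<close>.\<close>
  have "3/4 \<le> ?p ^ (4 * r)"
    using Bernoulli_inequality[of "- (1 / real M)" "4 * r"] M r by (simp add: field_simps)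
  then have "(3/4) ^ r \<le> (?p ^ (4 * r)) ^ r" by (intro power_mono) auto
  also have "\<dots> = ?p ^ (4 * r * r)" by (simp add: power_mult)
  also have "\<dots> \<le> ?p ^ (Suc r * Suc r)"
  proof (intro power_decreasing p)
    have "Suc r * Suc r \<le> (2 * r) * (2 * r)" using r by (intro mult_mono) auto
    then show "Suc r * Suc r \<le> 4 * r * r" by simp
  qed
  finally have dens: "(3/4) ^ r \<le> ?p ^ (Suc r * Suc r)" .
  \<comment> \<open>The exponent \<open>3 * r\<close> already leaves a factor 1/16 beside
    \<open>(3/4) ^ r\<close>, where less than 1/8 is required.\<close>
  have small: "4 * (1/4) ^ (96 * r) < (3/4 :: real) ^ r / 2"
  proof -
    have "(1/4 :: real) ^ (96 * r) \<le> (1/4) ^ (3 * r)" by (intro power_decreasing) auto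
    also have "\<dots> = (1/64) ^ r" by (simp add: power_mult power3_eq_cube)
    also have "\<dots> \<le> (3/4 * (1/16)) ^ r" by (intro power_mono) auto
    also have "\<dots> = (3/4) ^ r * (1/16) ^ r" by (rule power_mult_distrib)
    also have "(1/16 :: real) ^ r \<le> (1/16) ^ 1" using r by (intro power_decreasing) auto
    finally have "(1/4 :: real) ^ (96 * r) \<le> (3/4) ^ r * (1/16)" by simp
    moreover have "(3/4 :: real) ^ r > 0" by simp
    ultimately show ?thesis by linarith
  qed
  have ents: "entries r g \<subseteq> {..<2 ^ r} \<times> {..<2 ^ r}" for g by (auto simp: entries_def)
  have card_le: "real (card (entries r g)) \<le> 4 ^ r" for g
  proof -
    have "card (entries r g) \<le> card ({..<2 ^ r :: nat} \<times> {..<2 ^ r :: nat})"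
      by (intro card_mono ents) auto
    also have "\<dots> = 4 ^ r" by (simp add: power_mult_distrib[symmetric])
    finally show ?thesis by (metis of_nat_le_iff of_nat_numeral of_nat_power)
  qed
  have "real (card ?W) * (4 ^ r * (3/4) ^ r) \<le> real (card ?W) * (4 ^ r * ?p ^ (Suc r * Suc r))"
    by (intro mult_left_mono dens) auto
  also have "\<dots> = (\<Sum>g\<in>?W. real (card (entries r g)))"
    by (simp only: sum_card_entries[OF M(1)])
  also have "\<dots> \<le> (\<Sum>g\<in>?W. 4 ^ r * ((3/4) ^ r / 2) + (if g \<in> ?G then 4 ^ r else 0))"
  proof (rule sum_mono)
    fix g assume g: "g \<in> ?W"
    show "real (card (entries r g)) \<le> 4 ^ r * ((3/4) ^ r / 2) + (if g \<in> ?G then 4 ^ r else 0)"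
    proof (cases "g \<in> ?G")
      case True
      then have "(if g \<in> ?G then 4 ^ r else 0) = (4 ^ r :: real)" by (rule if_P)
      moreover have "0 \<le> (4 ^ r * ((3/4) ^ r / 2) :: real)" by simp
      ultimately show ?thesis using card_le[of g] by linarith
    next
      case False
      then have "\<not> grid_minor (2 ^ r) (96 * r) (entries r g)" using g by simp
      then have "\<not> 2 ^ r * ((3/2) ^ r / 2) \<le> real (card (entries r g))"
        using no ents[of g] by blast
      then have "real (card (entries r g)) < 2 ^ r * ((3/2) ^ r / 2)" by linarith
      also have "\<dots> = 4 ^ r * ((3/4) ^ r / 2)"
        by (simp add: power_mult_distrib[symmetric])
      finally show ?thesis unfolding if_not_P[OF False] by simp
    qed
  qed
  also have "\<dots> = real (card ?W) * (4 ^ r * ((3/4) ^ r / 2)) + real (card ?G) * 4 ^ r"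
    using finW by (simp add: sum.distrib sum.If_cases Int_def)
  also have "\<dots> \<le> real (card ?W) * (4 ^ r * ((3/4) ^ r / 2))
      + real (card ?W) * (4 * (1/4) ^ (96 * r)) * 4 ^ r"
    by (intro add_left_mono mult_right_mono G) auto
  also have "\<dots> = real (card ?W) * (4 ^ r * ((3/4) ^ r / 2 + 4 * (1/4) ^ (96 * r)))"
    by (simp add: algebra_simps)
  also have "\<dots> < real (card ?W) * (4 ^ r * ((3/4) ^ r / 2 + (3/4) ^ r / 2))"
    by (intro mult_strict_left_mono add_strict_left_mono small W) auto
  finally show False by simp
qed

subsection \<open>Block diagonal matrices\<close>

definition block_diagonal :: "nat \<Rightarrow> nat \<Rightarrow> (nat \<times> nat) set \<Rightarrow> (nat \<times> nat) set" where
  "block_diagonal N s A =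
     {(x, y). x div N = y div N \<and> x div N < s \<and> (x mod N, y mod N) \<in> A}"

lemma block_diagonal_subset:
  assumes "N > 0"
  shows "block_diagonal N s A \<subseteq> {..<s * N} \<times> {..<s * N}"
proof (rule subrelI)
  fix x y assume "(x, y) \<in> block_diagonal N s A"
  then have "x div N < s" "y div N < s" by (auto simp: block_diagonal_def)
  then show "(x, y) \<in> {..<s * N} \<times> {..<s * N}"
    using assms by (simp add: div_less_iff_less_mult)
qed

lemma card_block_diagonal_ge:
  assumes "A \<subseteq> {..<N} \<times> {..<N}" "N > 0"
  shows "s * card A \<le> card (block_diagonal N s A)"
proof -
  let ?f = "\<lambda>(q, i, j). (q * N + i, q * N + j)"
  have "card ({..<s} \<times> A) \<le> card (block_diagonal N s A)"
  proof (rule card_inj_on_le)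
    show "inj_on ?f ({..<s} \<times> A)"
    proof (rule inj_on_inverseI[where g = "\<lambda>(x, y). (x div N, x mod N, y mod N)"])
      fix p assume "p \<in> {..<s} \<times> A"
      moreover from this have "fst (snd p) < N" "snd (snd p) < N" using assms by auto
      ultimately show "(\<lambda>(x, y). (x div N, x mod N, y mod N)) (?f p) = p"
        by (cases p) auto
    qed
    show "?f ` ({..<s} \<times> A) \<subseteq> block_diagonal N s A"
    proof (rule image_subsetI)
      fix p assume "p \<in> {..<s} \<times> A"
      moreover from this have "fst (snd p) < N" "snd (snd p) < N" using assms by auto
      ultimately show "?f p \<in> block_diagonal N s A"
        by (cases p) (auto simp: block_diagonal_def)
    qed
    show "finite (block_diagonal N s A)"
      using block_diagonal_subset[OF assms(2)] by (rule finite_subset) simp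
  qed
  then show ?thesis by (simp add: card_cartesian_product)
qed

text \<open>Two base-\<open>l\<close> digits are swapped; the identity beyond the grid gives a
  permutation of every \<open>{..<k}\<close> with \<open>l * l \<le> k\<close>.\<close>

definition grid_transpose :: "nat \<Rightarrow> nat \<Rightarrow> nat" where
  "grid_transpose l t = (if t < l * l then (t mod l) * l + t div l else t)"

lemma grid_index_less:
  assumes "a < l" "b < l"
  shows "a * l + b < l * (l :: nat)"
proof -
  have "a * l + b < Suc a * l" using assms by simp
  also have "\<dots> \<le> l * l" using assms by (intro mult_right_mono) auto
  finally show ?thesis .
qed

lemma grid_transpose_index:
  "a < l \<Longrightarrow> b < l \<Longrightarrow> grid_transpose l (a * l + b) = b * l + a"
  using grid_index_less[of a l b] by (simp add: grid_transpose_def)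

lemma grid_transpose_cases:
  assumes "t < l * (l :: nat)"
  obtains a b where "a < l" "b < l" "t = a * l + b"
proof
  show "t div l < l" using assms by (simp add: less_mult_imp_div_less)
  show "t mod l < l" using assms by (cases l) auto
  show "t = t div l * l + t mod l" by simp
qed

lemma grid_transpose_less:
  assumes "l * l \<le> k" "t < k"
  shows "grid_transpose l t < k"
proof (cases "t < l * l")
  case True
  then obtain a b where ab: "a < l" "b < l" "t = a * l + b" by (rule grid_transpose_cases)
  then show ?thesis
    using grid_index_less[of b l a] assms by (simp add: grid_transpose_index)
qed (use assms in \<open>simp add: grid_transpose_def\<close>)

lemma grid_transpose_involution: "grid_transpose l (grid_transpose l t) = t"
proof (cases "t < l * l")
  case True
  then obtain a b where "a < l" "b < l" "t = a * l + b" by (rule grid_transpose_cases)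
  then show ?thesis by (simp add: grid_transpose_index)
qed (simp add: grid_transpose_def)

lemma bij_betw_grid_transpose:
  "l * l \<le> k \<Longrightarrow> bij_betw (grid_transpose l) {..<k} {..<k}"
  by (rule bij_betw_byWitness[where f' = "grid_transpose l"])
     (auto simp: grid_transpose_involution grid_transpose_less)

section \<open>Grid minors from transposed grids in block diagonal matrices\<close>

lemma mod_less_mod_if_same_div:
  "x < y \<Longrightarrow> x div N = y div N \<Longrightarrow> x mod N < y mod (N :: nat)"
  by (metis div_mult_mod_eq nat_add_left_cancel_less)

text \<open>The indices from \<open>l\<close> to below \<open>Suc m * l\<close> form the
  \<open>m\<close> inner lines of the grid. There \<open>f\<close> stays in one block, so residues
  keep the order and each line spans an interval. The two outer lines may meet other blocks, hence
  \<open>l = m + 2\<close>.\<close>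

lemma interval_family_blocks:
  fixes f :: "nat \<Rightarrow> nat"
  assumes mono: "strict_mono_on {..<l * l} f"
    and div: "\<And>t. l \<le> t \<Longrightarrow> t < Suc m * l \<Longrightarrow> f t div N = q"
    and l: "l = m + 2" and "N > 0"
  shows "interval_family N m (\<lambda>a. f (Suc a * l) mod N) (\<lambda>a. f (Suc a * l + Suc m) mod N)"
    and "\<And>a b. a < m \<Longrightarrow> b < m \<Longrightarrow>
      f (Suc a * l + Suc b) mod N \<in> {f (Suc a * l) mod N..f (Suc a * l + Suc m) mod N}"
proof -
  have less: "f t mod N < f t' mod N" if "l \<le> t" "t < t'" "t' < Suc m * l" for t t'
  proof (rule mod_less_mod_if_same_div)
    have "t' < l * l"
      using that l by (simp add: algebra_simps)
    then show "f t < f t'" using mono that by (intro strict_mono_onD[OF mono]) auto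
    show "f t div N = f t' div N" using div that by simp
  qed
  have ge: "l \<le> Suc a * l" for a by simp
  have lt: "Suc a * l + Suc m < Suc m * l" if "a < m" for a
  proof -
    have "Suc a * l + Suc m < Suc (Suc a) * l" using l by simp
    also have "\<dots> \<le> Suc m * l" using that by (intro mult_right_mono) auto
    finally show ?thesis .
  qed
  have le: "f t mod N \<le> f t' mod N" if "l \<le> t" "t \<le> t'" "t' < Suc m * l" for t t'
    using less[of t t'] that by (cases "t = t'") auto
  have gap: "f (Suc a' * l + Suc m) mod N < f (Suc a * l) mod N" if "a' < a" "a < m" for a a'
  proof (rule less)
    have "Suc a' * l + Suc m < Suc (Suc a') * l" using l by simp
    also have "\<dots> \<le> Suc a * l" using that by (intro mult_right_mono) auto
    finally show "Suc a' * l + Suc m < Suc a * l" .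
    show "Suc a * l < Suc m * l" using lt[OF that(2)] by linarith
  qed simp
  show "interval_family N m (\<lambda>a. f (Suc a * l) mod N) (\<lambda>a. f (Suc a * l + Suc m) mod N)"
    unfolding interval_family_def
  proof (intro conjI allI impI)
    fix a assume "a < m"
    show "f (Suc a * l) mod N \<le> f (Suc a * l + Suc m) mod N"
      by (rule le[OF ge _ lt[OF \<open>a < m\<close>]]) simp
    show "f (Suc a * l + Suc m) mod N < N" using \<open>N > 0\<close> by simp
  qed (rule gap)
  show "f (Suc a * l + Suc b) mod N \<in> {f (Suc a * l) mod N..f (Suc a * l + Suc m) mod N}"
    if "a < m" "b < m" for a b
  proof -
    have "Suc a * l + Suc b < Suc m * l" using lt[OF that(1)] that(2) by linarith
    then have "f (Suc a * l) mod N \<le> f (Suc a * l + Suc b) mod N"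
      by (intro le ge) auto
    moreover have "f (Suc a * l + Suc b) mod N \<le> f (Suc a * l + Suc m) mod N"
      using that by (intro le lt) auto
    ultimately show ?thesis by simp
  qed
qed

text \<open>
  The points of the grid in position \<open>(0, l - 1)\<close> and \<open>(l - 1, 0)\<close> lie in the same diagonal
  block, because rows force one order of their blocks and columns the other; this block then
  contains every point between them.
\<close>

lemma grid_minor_of_pattern_in_block_diagonal:
  fixes \<rho> \<gamma> :: "nat \<Rightarrow> nat"
  assumes mono: "strict_mono_on {..<l * l} \<rho>" "strict_mono_on {..<l * l} \<gamma>"
    and pattern: "\<And>t. t < l * l \<Longrightarrow> (\<rho> t, \<gamma> (grid_transpose l t)) \<in> block_diagonal N s A"
    and l: "l = m + 2" and N: "N > 0"
  shows "grid_minor N m A"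
proof -
  have point: "\<rho> (a * l + b) div N = \<gamma> (b * l + a) div N"
    "(\<rho> (a * l + b) mod N, \<gamma> (b * l + a) mod N) \<in> A" if "a < l" "b < l" for a b
    using pattern[OF grid_index_less[OF that]] grid_transpose_index[OF that]
    by (auto simp: block_diagonal_def)
  have last: "Suc m * l < l * l" "Suc m \<le> Suc m * l" using l by auto
  have dle: "\<rho> t div N \<le> \<rho> t' div N" "\<gamma> t div N \<le> \<gamma> t' div N" if "t \<le> t'" "t' < l * l" for t t'
    using that strict_mono_on_imp_mono_on[OF mono(1)] strict_mono_on_imp_mono_on[OF mono(2)]
    by (simp_all add: div_le_mono monotone_on_def)
  define q where "q = \<rho> (Suc m) div N"
  have "\<rho> (Suc m) div N = \<gamma> (Suc m * l) div N" "\<rho> (Suc m * l) div N = \<gamma> (Suc m) div N"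
    using point(1)[of 0 "Suc m"] point(1)[of "Suc m" 0] l by simp_all
  then have ends: "\<gamma> (Suc m) div N = q" "\<gamma> (Suc m * l) div N = q" "\<rho> (Suc m * l) div N = q"
    using dle[OF last(2,1)] unfolding q_def by linarith+
  have div: "\<rho> t div N = q" "\<gamma> t div N = q" if "l \<le> t" "t < Suc m * l" for t
    using dle[of "Suc m" t] dle[of t "Suc m * l"] that last l ends
    by (simp_all add: q_def)
  note R = interval_family_blocks[OF mono(1) div(1) l N]
  note C = interval_family_blocks[OF mono(2) div(2) l N]
  \<comment> \<open>Transposition pairs row index \<open>Suc a * l + Suc b\<close> with column index
    \<open>Suc b * l + Suc a\<close>, so this point lies in row interval \<open>a\<close> and column
    interval \<open>b\<close>.\<close>
  have "\<exists>i\<in>{\<rho> (Suc a * l) mod N..\<rho> (Suc a * l + Suc m) mod N}.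
      \<exists>j\<in>{\<gamma> (Suc b * l) mod N..\<gamma> (Suc b * l + Suc m) mod N}. (i, j) \<in> A" if "a < m" "b < m" for a b
    using R(2)[OF _ _ that] C(2)[OF _ _ that(2,1)] point(2)[of "Suc a" "Suc b"] that l
    by (intro bexI) auto
  then show ?thesis
    unfolding grid_minor_def using R(1) C(1) by blast
qed

subsection \<open>Passage to \<open>d\<close> dimensions\<close>

text \<open>The shifts by 1 translate indices counted from 1 into pairs counted from 0.\<close>

definition lift_matrix :: "nat \<Rightarrow> nat \<Rightarrow> (nat \<times> nat) set \<Rightarrow> (nat \<Rightarrow> nat) \<Rightarrow> nat" where
  "lift_matrix d n B = (\<lambda>i\<in>index_set d (\<lambda>_. n). if (i 1 - 1, i 2 - 1) \<in> B then 1 else 0)"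

lemma lift_matrix_eq_oneD:
  assumes "lift_matrix d n B i = 1" "i \<in> index_set d (\<lambda>_. n)"
  shows "(i 1 - 1, i 2 - 1) \<in> B"
proof (rule ccontr)
  assume "(i 1 - 1, i 2 - 1) \<notin> B"
  then have "lift_matrix d n B i = 0"
    unfolding lift_matrix_def restrict_apply'[OF assms(2)] by (rule if_not_P)
  then show False using assms(1) by simp
qed

definition diagonal_point :: "nat \<Rightarrow> (nat \<Rightarrow> nat) \<Rightarrow> nat \<Rightarrow> nat \<Rightarrow> nat" where
  "diagonal_point d \<sigma> t = (\<lambda>l\<in>{1..d}. if l = 2 then Suc (\<sigma> t) else Suc t)"

definition diagonal_pattern :: "nat \<Rightarrow> nat \<Rightarrow> (nat \<Rightarrow> nat) \<Rightarrow> (nat \<Rightarrow> nat) \<Rightarrow> nat" where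
  "diagonal_pattern d k \<sigma> =
     (\<lambda>i\<in>index_set d (\<lambda>_. k). if i \<in> diagonal_point d \<sigma> ` {..<k} then 1 else 0)"

lemma diagonal_point_in_index_set:
  "\<sigma> t < k \<Longrightarrow> t < k \<Longrightarrow> diagonal_point d \<sigma> t \<in> index_set d (\<lambda>_. k)"
  unfolding diagonal_point_def index_set_def by (rule restrict_PiE_iff[THEN iffD2]) simp

lemma diagonal_pattern_in_permutation_matrices:
  assumes \<sigma>: "bij_betw \<sigma> {..<k} {..<k}"
  shows "diagonal_pattern d k \<sigma> \<in> permutation_matrices d k"
proof -
  have less: "\<sigma> t < k" if "t < k" for t using bij_betwE[OF \<sigma>] that by auto
  have "\<exists>!i. i \<in> cross_section d (\<lambda>_. k) l t \<and> diagonal_pattern d k \<sigma> i \<noteq> 0"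
    if lt: "l \<in> {1..d}" "t \<in> {1..k}" for l t
  proof -
    let ?f = "if l = 2 then \<sigma> else id"
    have f: "bij_betw ?f {..<k} {..<k}" using \<sigma> by simp
    have "t - 1 \<in> {..<k}" using lt by auto
    then have "t - 1 \<in> ?f ` {..<k}" unfolding bij_betw_imp_surj_on[OF f] .
    then obtain u where u: "u < k" "t - 1 = ?f u" by blast
    have uniq: "v = u" if "v < k" "?f v = t - 1" for v
      using inj_onD[OF bij_betw_imp_inj_on[OF f], of v u] u that by simp
    have pt: "diagonal_point d \<sigma> v l = Suc (?f v)" for v
      using lt by (simp add: diagonal_point_def)
    have "Suc (?f u) = t" using u(2) lt(2) by (simp only: atLeastAtMost_iff) linarith
    then have ut: "diagonal_point d \<sigma> u l = t" unfolding pt .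
    show ?thesis
    proof (rule ex1I[of _ "diagonal_point d \<sigma> u"])
      show "diagonal_point d \<sigma> u \<in> cross_section d (\<lambda>_. k) l t \<and>
          diagonal_pattern d k \<sigma> (diagonal_point d \<sigma> u) \<noteq> 0"
        using u(1) ut diagonal_point_in_index_set[of \<sigma> u k d] less[of u]
        by (simp add: cross_section_def diagonal_pattern_def)
      fix i assume i: "i \<in> cross_section d (\<lambda>_. k) l t \<and> diagonal_pattern d k \<sigma> i \<noteq> 0"
      then obtain v where v: "v < k" "i = diagonal_point d \<sigma> v"
        by (auto simp: cross_section_def diagonal_pattern_def split: if_splits)
      have "i l = t" using i by (simp add: cross_section_def)
      then have "?f v = t - 1" using pt[of v] v(2) by simp
      then show "i = diagonal_point d \<sigma> u" using uniq v by blast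
    qed
  qed
  moreover have "diagonal_pattern d k \<sigma> \<in> zero_one_matrices d (\<lambda>_. k)"
    unfolding diagonal_pattern_def zero_one_matrices_def
    by (rule restrict_PiE_iff[THEN iffD2]) simp
  ultimately show ?thesis by (simp add: permutation_matrices_def)
qed

text \<open>Entries of the lifted matrix depend on the first two coordinates alone, so the
  increasing enumerations of \<open>S 1\<close> and \<open>S 2\<close>, shifted to start from 0,
  place the permutation in \<open>B\<close>.\<close>

lemma contains_diagonal_pattern_imp:
  assumes contains: "contains_matrix d (\<lambda>_. n) (lift_matrix d n B) (\<lambda>_. k) (diagonal_pattern d k \<sigma>)"
    and d: "d \<ge> 2" and \<sigma>: "\<And>t. t < k \<Longrightarrow> \<sigma> t < k"
  obtains \<rho> \<gamma> where "strict_mono_on {..<k} \<rho>" "strict_mono_on {..<k} \<gamma>"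
    "\<And>t. t < k \<Longrightarrow> (\<rho> t, \<gamma> (\<sigma> t)) \<in> B"
proof -
  obtain S where S: "\<And>l. l \<in> {1..d} \<Longrightarrow> S l \<subseteq> {1..n}" "\<And>l. l \<in> {1..d} \<Longrightarrow> card (S l) = k"
    and sub: "ones_to_zeros d (\<lambda>_. k) (submatrix d S (lift_matrix d n B)) (diagonal_pattern d k \<sigma>)"
    using contains unfolding contains_matrix_def by blast
  define f where "f l t = sorted_list_of_set (S l) ! t" for l t
  have fin: "finite (S l)" if "l \<in> {1..d}" for l
    using S(1)[OF that] by (rule finite_subset) simp
  have len: "length (sorted_list_of_set (S l)) = k" if "l \<in> {1..d}" for l
    using S(2)[OF that] by simp
  have f_in: "f l t \<in> {1..n}" if "l \<in> {1..d}" "t < k" for l t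
  proof -
    have "f l t \<in> set (sorted_list_of_set (S l))"
      unfolding f_def using that(2) len[OF that(1)] by (intro nth_mem) simp
    then show ?thesis using S(1)[OF that(1)] fin[OF that(1)] by auto
  qed
  have f_mono: "f l t < f l t'" if "l \<in> {1..d}" "t < t'" "t' < k" for l t t'
    using sorted_wrt_nth_less[OF sorted_list_of_set.strict_sorted_key_list_of_set[of "S l"] that(2)]
      that len by (simp add: f_def)
  have idx: "index_set d (\<lambda>l. card (S l)) = index_set d (\<lambda>_. k)"
    unfolding index_set_def using S(2) by (intro PiE_cong) simp
  have "(f 1 t - 1, f 2 (\<sigma> t) - 1) \<in> B" if t: "t < k" for t
  proof -
    let ?i = "diagonal_point d \<sigma> t"
    let ?j = "\<lambda>l\<in>{1..d}. sorted_list_of_set (S l) ! (?i l - 1)"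
    have i: "?i \<in> index_set d (\<lambda>_. k)" using t \<sigma> by (simp add: diagonal_point_in_index_set)
    moreover have "diagonal_pattern d k \<sigma> ?i = 1" using i t by (simp add: diagonal_pattern_def)
    ultimately have "submatrix d S (lift_matrix d n B) ?i = 1"
      using sub unfolding ones_to_zeros_def by fastforce
    then have "lift_matrix d n B ?j = 1"
      using i by (simp add: submatrix_def idx)
    moreover have j: "?j l = f l (if l = 2 then \<sigma> t else t)" if "l \<in> {1..d}" for l
      using that by (simp add: f_def diagonal_point_def)
    moreover have "?j \<in> index_set d (\<lambda>_. n)"
    proof -
      have "?j l \<in> {1..n}" if "l \<in> {1..d}" for l
        unfolding j[OF that] using f_in that t \<sigma> by simp
      then show ?thesis unfolding index_set_def by (intro PiE_I) auto
    qed
    ultimately have "(?j 1 - 1, ?j 2 - 1) \<in> B"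
      by (intro lift_matrix_eq_oneD)
    then show ?thesis using j[of 1] j[of 2] d by simp
  qed
  moreover have "strict_mono_on {..<k} (\<lambda>t. f l t - 1)" if "l \<in> {1..d}" for l
  proof (rule strict_mono_onI)
    fix t t' assume "t \<in> {..<k}" "t' \<in> {..<k}" "t < t'"
    then show "f l t - 1 < f l t' - 1"
      using f_mono[OF that, of t t'] f_in[OF that, of t] by auto
  qed
  ultimately show ?thesis using that[of "\<lambda>t. f 1 t - 1" "\<lambda>t. f 2 t - 1"] d by simp
qed

lemma lift_matrix_in_zero_one_matrices: "lift_matrix d n B \<in> zero_one_matrices d (\<lambda>_. n)"
  unfolding lift_matrix_def zero_one_matrices_def by (rule restrict_PiE_iff[THEN iffD2]) simp

text \<open>Each pair in \<open>B\<close> extends by \<open>n ^ (d - 2)\<close> choices of the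
  coordinates from 3 on.\<close>

lemma num_ones_lift_matrix_ge:
  assumes d: "d \<ge> 2" and B: "B \<subseteq> {..<n} \<times> {..<n}"
  shows "card B * n ^ (d - 2) \<le> num_ones d (\<lambda>_. n) (lift_matrix d n B)"
proof -
  let ?H = "{3..d} \<rightarrow>\<^sub>E {1..n}"
  let ?f = "\<lambda>(p, h). \<lambda>l\<in>{1..d}. if l = 1 then Suc (fst p) else if l = 2 then Suc (snd p) else h l"
  let ?g = "\<lambda>i. ((i 1 - 1, i 2 - 1), restrict i {3..d})"
  let ?ones = "{i \<in> index_set d (\<lambda>_. n). lift_matrix d n B i = 1}"
  have fin: "finite (index_set d (\<lambda>_. n))" by (simp add: index_set_def finite_PiE)
  have "card (B \<times> ?H) \<le> card ?ones"
  proof (rule card_inj_on_le)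
    show "inj_on ?f (B \<times> ?H)"
    proof (rule inj_on_inverseI[where g = ?g])
      fix q assume "q \<in> B \<times> ?H"
      then obtain p h where q: "q = (p, h)" "h \<in> ?H" by auto
      have "restrict (?f q) {3..d} = h"
      proof (rule extensionalityI[of _ "{3..d}"])
        show "h \<in> extensional {3..d}" using q(2) by (simp add: PiE_iff)
      qed (auto simp: q)
      then show "?g (?f q) = q" using d by (simp add: q)
    qed
    show "?f ` (B \<times> ?H) \<subseteq> ?ones"
    proof (rule image_subsetI)
      fix q assume "q \<in> B \<times> ?H"
      then obtain p h where q: "q = (p, h)" "p \<in> B" "h \<in> ?H" by auto
      then have p: "fst p < n" "snd p < n" using B by auto
      have h: "h l \<in> {1..n}" if "l \<in> {1..d}" "l \<noteq> 1" "l \<noteq> 2" for l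
      proof -
        have "l \<in> {3..d}" using that by auto
        then show ?thesis using q(3) by (rule PiE_mem[rotated])
      qed
      have "?f q \<in> index_set d (\<lambda>_. n)"
        unfolding index_set_def q prod.case
      proof (rule restrict_PiE_iff[THEN iffD2], rule ballI)
        fix l assume "l \<in> {1..d}"
        then show "(if l = 1 then Suc (fst p) else if l = 2 then Suc (snd p) else h l) \<in> {1..n}"
          using p h[of l] by simp
      qed
      moreover from this have "lift_matrix d n B (?f q) = 1"
        using q(2) d by (simp add: lift_matrix_def q)
      ultimately show "?f q \<in> ?ones" by simp
    qed
    show "finite ?ones" using fin by simp
  qed
  moreover have "card ?H = n ^ (d - 2)" by (simp add: card_PiE)
  ultimately show ?thesis by (simp add: num_ones_def card_cartesian_product)
qed

lemma num_ones_le_ex_ones: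
  assumes "A \<in> zero_one_matrices d (\<lambda>_. n)" "\<not> contains_matrix d (\<lambda>_. n) A m B"
  shows "num_ones d (\<lambda>_. n) A \<le> ex_ones d m B n"
  unfolding ex_ones_def
proof (rule Max_ge)
  have "finite (zero_one_matrices d (\<lambda>_. n))"
    by (simp add: zero_one_matrices_def index_set_def finite_PiE)
  then show "finite {num_ones d (\<lambda>_. n) A |A.
      A \<in> zero_one_matrices d (\<lambda>_. n) \<and> \<not> contains_matrix d (\<lambda>_. n) A m B}"
    by simp
qed (use assms in blast)

text \<open>The blocks have \<open>(3/2) ^ r / 2\<close> ones per row on average and, for
  \<open>n \<ge> N\<close>, cover at least half of the \<open>n\<close> rows; hence the 4.\<close>

lemma I_lim_diagonal_pattern_ge:
  assumes d: "d \<ge> 2" and r: "r \<ge> 1" and l: "l = 96 * r + 2" and k: "l * l \<le> k"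
  shows "I_lim d (\<lambda>_. k) (diagonal_pattern d k (grid_transpose l)) \<ge> ereal ((3/2) ^ r / 4)"
proof -
  define N where "N = (2 :: nat) ^ r"
  obtain A where A: "A \<subseteq> {..<N} \<times> {..<N}" "\<not> grid_minor N (96 * r) A"
    "real N * ((3/2) ^ r / 2) \<le> real (card A)"
    using ex_dense_no_grid_minor[OF r] by (auto simp: N_def)
  have N: "N > 0" by (simp add: N_def)
  have "(3/2) ^ r / 4 \<le>
      real (ex_ones d (\<lambda>_. k) (diagonal_pattern d k (grid_transpose l)) n) / real n ^ (d - 1)"
    if n: "n \<ge> N" for n
  proof -
    define s where "s = n div N"
    define B where "B = block_diagonal N s A"
    have "s * N \<le> n" by (simp add: s_def)
    then have B: "B \<subseteq> {..<n} \<times> {..<n}"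
      using block_diagonal_subset[OF N, of s A] unfolding B_def by fastforce
    have "\<not> contains_matrix d (\<lambda>_. n) (lift_matrix d n B) (\<lambda>_. k)
        (diagonal_pattern d k (grid_transpose l))"
    proof
      assume "contains_matrix d (\<lambda>_. n) (lift_matrix d n B) (\<lambda>_. k)
        (diagonal_pattern d k (grid_transpose l))"
      then obtain \<rho> \<gamma> where mono: "strict_mono_on {..<k} \<rho>" "strict_mono_on {..<k} \<gamma>"
        and pt: "\<And>t. t < k \<Longrightarrow> (\<rho> t, \<gamma> (grid_transpose l t)) \<in> B"
        using contains_diagonal_pattern_imp d grid_transpose_less[OF k] by blast
      have "{..<l * l} \<subseteq> {..<k}" using k by simp
      then have "strict_mono_on {..<l * l} \<rho>" "strict_mono_on {..<l * l} \<gamma>"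
        using mono monotone_on_subset by blast+
      then have "grid_minor N (96 * r) A"
        using pt k l N unfolding B_def
        by (intro grid_minor_of_pattern_in_block_diagonal[of l \<rho> \<gamma> N s]) auto
      then show False using A(2) by simp
    qed
    then have "num_ones d (\<lambda>_. n) (lift_matrix d n B)
        \<le> ex_ones d (\<lambda>_. k) (diagonal_pattern d k (grid_transpose l)) n" (is "_ \<le> ?e")
      by (rule num_ones_le_ex_ones[OF lift_matrix_in_zero_one_matrices])
    moreover have "s * card A * n ^ (d - 2) \<le> card B * n ^ (d - 2)"
      unfolding B_def by (intro mult_right_mono card_block_diagonal_ge A N) simp
    ultimately have "s * card A * n ^ (d - 2) \<le> ?e"
      using num_ones_lift_matrix_ge[OF d B] by linarith
    then have e: "real s * real (card A) * real n ^ (d - 2) \<le> real ?e"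
      by (metis of_nat_le_iff of_nat_mult of_nat_power)
    have "1 \<le> s" using n N by (simp add: s_def div_greater_zero_iff Suc_le_eq)
    have "n = s * N + n mod N" by (simp add: s_def)
    also have "\<dots> < s * N + N" using N by simp
    also have "\<dots> \<le> s * N + s * N" using \<open>1 \<le> s\<close> by simp
    finally have "real n \<le> 2 * (real s * real N)"
      by (metis less_imp_le_nat mult_2 of_nat_le_iff of_nat_mult of_nat_numeral)
    then have "(3/2) ^ r / 4 * real n \<le> (3/2) ^ r / 4 * (2 * (real s * real N))"
      by (intro mult_left_mono) auto
    also have "\<dots> = real s * (real N * ((3/2) ^ r / 2))" by simp
    also have "\<dots> \<le> real s * real (card A)" by (intro mult_left_mono A) simp
    finally have "(3/2) ^ r / 4 * real n * real n ^ (d - 2) \<le> real s * real (card A) * real n ^ (d - 2)"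
      by (intro mult_right_mono) auto
    also note e
    also have "(3/2) ^ r / 4 * real n * real n ^ (d - 2) = (3/2) ^ r / 4 * real n ^ (d - 1)"
      using d power_Suc[of "real n" "d - 2"] by (simp add: Suc_diff_Suc numeral_2_eq_2)
    finally show ?thesis using n N by (simp add: pos_le_divide_eq)
  qed
  then show ?thesis
    unfolding I_lim_def by (intro Liminf_bounded) (auto simp: eventually_sequentially)
qed

section \<open>Numerical choice of the grid size\<close>

lemma ex_grid_size:
  fixes k :: nat
  assumes "k \<ge> 1000000"
  shows "\<exists>r\<ge>1. (96 * r + 2) * (96 * r + 2) \<le> k \<and>
    2 powr (sqrt (real k) / 776) \<le> (3/2) ^ r / 4"
proof -
  have "1000\<^sup>2 \<le> real k" using assms by simp
  then have s: "1000 \<le> sqrt (real k)" by (rule real_le_rsqrt)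
  \<comment> \<open>The largest \<open>r\<close> for which a grid of side \<open>96 * r + 2\<close>
    fits into \<open>k\<close>.\<close>
  define r where "r = nat \<lfloor>(sqrt (real k) - 2) / 96\<rfloor>"
  have "real r = of_int \<lfloor>(sqrt (real k) - 2) / 96\<rfloor>" using s by (simp add: r_def)
  then have r: "real r \<le> (sqrt (real k) - 2) / 96" "(sqrt (real k) - 2) / 96 < real r + 1"
    by linarith+
  have r': "sqrt (real k) < 96 * real r + 98" using r(2) by (simp add: divide_less_eq)
  then have r8: "8 \<le> real r" using s by linarith
  have "real (96 * r + 2) \<le> sqrt (real k)" using r(1) by simp
  then have "real (96 * r + 2) * real (96 * r + 2) \<le> sqrt (real k) * sqrt (real k)"
    by (intro mult_mono) auto
  also have "\<dots> = real k" by simp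
  finally have "(96 * r + 2) * (96 * r + 2) \<le> k"
    by (metis of_nat_le_iff of_nat_mult)
  moreover have "2 powr (sqrt (real k) / 776) \<le> (3/2) ^ r / 4"
  proof -
    \<comment> \<open>The 2 pays for the divisor 4, and \<open>r / 2\<close> is used with
      \<open>2 \<le> 9/4 = (3/2)\<^sup>2\<close>. For large \<open>r\<close> any denominator above
      192 would do; 776 works from \<open>r = 8\<close> on.\<close>
    have "sqrt (real k) / 776 \<le> real r / 2 - 2" using r' r8 by linarith
    then have "2 powr (sqrt (real k) / 776) \<le> 2 powr (real r / 2 - 2)" by simp
    also have "\<dots> = 2 powr (real r / 2) / 4" by (simp add: powr_diff)
    also have "2 powr (real r / 2) \<le> (9/4) powr (real r / 2)" by (intro powr_mono2) auto
    also have "(9/4) powr (real r / 2) = (((3/2) powr 2) powr (real r / 2) :: real)" by (simp add: power2_eq_square)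
    also have "\<dots> = (3/2) ^ r" by (simp only: powr_powr) (simp add: powr_realpow)
    finally show ?thesis by simp
  qed
  moreover have "r \<ge> 1" using r8 by simp
  ultimately show ?thesis by blast
qed

theorem theorem4p6:
  fixes d :: nat
  assumes "d \<ge> 2"
  shows "\<exists>c::real>0. \<exists>k0::nat. \<forall>k\<ge>k0.
           \<exists>F. F \<noteq> {} \<and> F \<subseteq> permutation_matrices d k \<and>
             (\<forall>P\<in>F. I_lim d (\<lambda>_. k) P \<ge> ereal (2 powr (c * real k powr (1 / real d))))"
proof (rule exI[of _ "1 / 776"], rule conjI, simp, rule exI[of _ 1000000], intro allI impI)
  fix k :: nat assume k: "k \<ge> 1000000"
  obtain r where r: "r \<ge> 1" "(96 * r + 2) * (96 * r + 2) \<le> k"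
    "2 powr (sqrt (real k) / 776) \<le> (3/2) ^ r / 4"
    using ex_grid_size[OF k] by blast
  let ?P = "diagonal_pattern d k (grid_transpose (96 * r + 2))"
  have "real k powr (1 / real d) \<le> real k powr (1 / 2)"
    using assms k by (intro powr_mono) (auto simp: field_simps)
  also have "\<dots> = sqrt (real k)" by (simp add: powr_half_sqrt)
  finally have "2 powr (1 / 776 * real k powr (1 / real d)) \<le> 2 powr (sqrt (real k) / 776)"
    by simp
  also note r(3)
  finally have "ereal (2 powr (1 / 776 * real k powr (1 / real d))) \<le> ereal ((3/2) ^ r / 4)"
    by simp
  also have "\<dots> \<le> I_lim d (\<lambda>_. k) ?P"
    using I_lim_diagonal_pattern_ge[OF assms r(1) refl r(2)] .
  finally have "I_lim d (\<lambda>_. k) ?P \<ge> ereal (2 powr (1 / 776 * real k powr (1 / real d)))" .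
  moreover have "?P \<in> permutation_matrices d k"
    using r(2) by (intro diagonal_pattern_in_permutation_matrices bij_betw_grid_transpose)
  ultimately show "\<exists>F. F \<noteq> {} \<and> F \<subseteq> permutation_matrices d k \<and>
      (\<forall>P\<in>F. I_lim d (\<lambda>_. k) P \<ge> ereal (2 powr (1 / 776 * real k powr (1 / real d))))"
    by (intro exI[of _ "{?P}"]) simp
qed

end
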